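(* Let $n\ge1$. Assume that $u\in C^{1,1}_{loc}(\mathbb{R}^n)\cap L_\alpha$ (for $\alpha<2$ close to $2$), that $G:\mathbb{R}\to\mathbb{R}$ is second order differentiable, and that $G(0)=0$. Then for each fixed $x\in\mathbb{R}^n$, $$\lim_{\alpha\to2^-}F_\alpha(u(x))=a\,(-\Delta u)(x)+b\,|\nabla u(x)|^2,$$ where $a$ and $b$ are constant multiples of $G'(0)$ and $G''(0)$ respectively, the multiplicative constants depending only on $n$.
   Context: For $0<\alpha<2$, $$F_\alpha(u(x)) = C_{n,\alpha}\lim_{\epsilon\to0}\int_{\mathbb{R}^n\setminus B_\epsilon(x)}\frac{G(u(x)-u(z))}{|x-z|^{n+\alpha}}\,dz,$$ where the normalization constant is $C_{n,\alpha}=c_n(2-\alpha)$ with $c_n>0$ depending only on $n$. It is understood that $F_\alpha(u(x))$ is well defined. The space $L_\alpha$ is $$L_\alpha=\Big\{u\in L^1_{loc}(\mathbb{R}^n)\ :\ \int_{\mathbb{R}^n}\frac{|u(x)|}{1+|x|^{n+\alpha}}\,dx<\infty\Big\}.$$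
   Formalization: The gradient of u is additionally assumed differentiable at the fixed point x: a C^{1,1}_loc function may have no Laplacian there (u(t)=t|t|/2 at 0), and existence of pure second partials alone is not enough (x²y²/(x²+y²) at 0). *)

theory Defs
  imports "HOL-Analysis.Analysis"
begin

definition partial_deriv :: "'n \<Rightarrow> (real ^ 'n \<Rightarrow> real) \<Rightarrow> real ^ 'n \<Rightarrow> real" where
  "partial_deriv i u x = deriv (\<lambda>t. u (x + t *\<^sub>R axis i 1)) 0"

definition grad :: "(real ^ 'n \<Rightarrow> real) \<Rightarrow> real ^ 'n \<Rightarrow> real ^ 'n" where
  "grad u x = (\<chi> i. partial_deriv i u x)"

definition laplacian :: "(real ^ 'n \<Rightarrow> real) \<Rightarrow> real ^ 'n \<Rightarrow> real" where
  "laplacian u x = (\<Sum>i\<in>UNIV. partial_deriv i (partial_deriv i u) x)"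

text \<open>A function in \<open>C11_loc\<close> need not have second derivatives at every point (only almost
  everywhere), so \<^const>\<open>laplacian\<close> is meaningful only where \<^const>\<open>grad\<close> \<open>u\<close> is
  differentiable.\<close>

definition C11_loc :: "(real ^ 'n \<Rightarrow> real) set" where
  "C11_loc = {u. (\<forall>x. u differentiable (at x)) \<and>
     (\<forall>K. compact K \<longrightarrow> (\<exists>L. L-lipschitz_on K (grad u)))}"

definition L_space :: "real \<Rightarrow> (real ^ 'n \<Rightarrow> real) set" where
  "L_space \<alpha> = {u. (\<forall>K. compact K \<longrightarrow> u absolutely_integrable_on K) \<and>
     (\<lambda>x. \<bar>u x\<bar> / (1 + norm x powr (real CARD('n) + \<alpha>))) absolutely_integrable_on UNIV}"

definition F_kernel ::
  "real \<Rightarrow> (real \<Rightarrow> real) \<Rightarrow> (real ^ 'n \<Rightarrow> real) \<Rightarrow> real ^ 'n \<Rightarrow> real ^ 'n \<Rightarrow> real" where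
  "F_kernel \<alpha> G u x z = G (u x - u z) / norm (x - z) powr (real CARD('n) + \<alpha>)"

definition F_trunc ::
  "real \<Rightarrow> (real \<Rightarrow> real) \<Rightarrow> (real ^ 'n \<Rightarrow> real) \<Rightarrow> real ^ 'n \<Rightarrow> real \<Rightarrow> real" where
  "F_trunc \<alpha> G u x \<epsilon> = set_lebesgue_integral lebesgue (- ball x \<epsilon>) (F_kernel \<alpha> G u x)"

text \<open>Bochner integrals and \<^const>\<open>Lim\<close> are total, so the requirement that the principal
  value exists is kept as a separate predicate.\<close>

definition F_well_defined ::
  "real \<Rightarrow> (real \<Rightarrow> real) \<Rightarrow> (real ^ 'n \<Rightarrow> real) \<Rightarrow> real ^ 'n \<Rightarrow> bool" where
  "F_well_defined \<alpha> G u x \<longleftrightarrow>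
     (\<forall>\<epsilon>>0. set_integrable lebesgue (- ball x \<epsilon>) (F_kernel \<alpha> G u x)) \<and>
     (\<exists>l. (F_trunc \<alpha> G u x \<longlongrightarrow> l) (at_right 0))"

text \<open>The normalization constant is \<open>C\<^sub>n\<^sub>,\<^sub>\<alpha> = c n * (2 - \<alpha>)\<close>, where the function \<open>c\<close> of the
  dimension is a parameter.\<close>

definition F_op ::
  "(nat \<Rightarrow> real) \<Rightarrow> real \<Rightarrow> (real \<Rightarrow> real) \<Rightarrow> (real ^ 'n \<Rightarrow> real) \<Rightarrow> real ^ 'n \<Rightarrow> real" where
  "F_op c \<alpha> G u x = c CARD('n) * (2 - \<alpha>) * Lim (at_right 0) (F_trunc \<alpha> G u x)"

definition twice_differentiable :: "(real \<Rightarrow> real) \<Rightarrow> bool" where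
  "twice_differentiable G \<longleftrightarrow>
     (\<forall>t. G differentiable (at t)) \<and> (\<forall>t. deriv G differentiable (at t))"

end

theory Submission
  imports Defs
begin

text \<open>
  The function \<open>h \<mapsto> G (u x - u (x + h))\<close> vanishes at \<open>0\<close> and is twice differentiable there, so
  it has a second-order expansion \<open>b \<bullet> h + (E h \<bullet> h) / 2 + o(\<bar>h\<bar>\<^sup>2)\<close> whose quadratic part has trace
  \<open>G''(0) \<bar>\<nabla>u\<bar>\<^sup>2 - G'(0) \<Delta>u\<close>. Against the kernel \<open>\<bar>h\<bar> powr - (n + \<alpha>)\<close> on an annulus \<open>e \<le> \<bar>h\<bar> < d\<close>
  the linear part integrates to \<open>0\<close>, and by symmetry the quadratic part gives half the trace times
  the volume of the unit ball times \<open>(d powr (2 - \<alpha>) - e powr (2 - \<alpha>)) / (2 - \<alpha>)\<close>. The factor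
  \<open>2 - \<alpha>\<close> cancels this singularity, makes the error term small uniformly in \<open>\<alpha>\<close>, and kills the
  contribution of \<open>\<bar>h\<bar> \<ge> d\<close>, which stays bounded as \<open>\<alpha>\<close> tends to \<open>2\<close>.
\<close>

section \<open>Radial integration over a ball\<close>

text \<open>Two Borel measures on the line with finite, equal values on all half-lines
  \<open>{x<..}\<close> coincide. On the left such a value is the volume of a spherical shell; on
  the right it follows from the fundamental theorem of calculus. Restricting to a ball is what makes
  these values finite.\<close>

lemma distr_norm_lborel_ball:
  assumes "0 \<le> d"
  shows "distr (density lborel (indicator (ball (0::'a::euclidean_space) d))) borel norm =
    density lborel (\<lambda>r. ennreal (real DIM('a) * unit_ball_vol (real DIM('a)) * r ^ (DIM('a) - 1) * indicator {0..d} r))"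
    (is "?M = ?N")
proof (rule measure_eqI_lessThan)
  let ?n = "DIM('a)" and ?V = "unit_ball_vol (real DIM('a))"
  have tail_M: "emeasure ?M {x<..} = ennreal (?V * (d ^ ?n - (min (max x 0) d) ^ ?n))" for x
  proof -
    \<comment> \<open>Clamping \<open>x\<close> to \<open>[0, d]\<close> lets one shell formula
      cover negative \<open>x\<close> and \<open>x\<close> beyond \<open>d\<close> as well.\<close>
    define y where "y = min (max x 0) d"
    have y: "0 \<le> y" "y \<le> d" using assms by (auto simp: y_def)
    have "emeasure ?M {x<..} = emeasure lborel (ball 0 d \<inter> {h::'a. x < norm h})"
    proof -
      have "emeasure ?M {x<..} = emeasure (density lborel (indicator (ball (0::'a) d))) {h. x < norm h}"
        by (subst emeasure_distr) (auto simp: vimage_def)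
      also have "\<dots> = (\<integral>\<^sup>+h. indicator (ball 0 d \<inter> {h::'a. x < norm h}) h \<partial>lborel)"
        by (subst emeasure_density) (simp_all add: borel_measurable_indicator indicator_inter_arith[abs_def])
      finally show ?thesis by simp
    qed
    also have "\<dots> = emeasure lborel (ball 0 d - cball (0::'a) y)"
    proof (rule emeasure_eq_AE)
      \<comment> \<open>The two sets can differ only at the origin: for \<open>x < 0\<close> the
        closed ball of radius \<open>y = 0\<close> removes it.\<close>
      have "AE h in lborel. h \<noteq> (0::'a)"
        using AE_lborel_singleton by blast
      then show "AE h in lborel. (h \<in> ball 0 d \<inter> {h::'a. x < norm h}) = (h \<in> ball 0 d - cball 0 y)"
        by eventually_elim (use assms in \<open>auto simp: y_def min_def max_def split: if_splits intro: order.strict_trans1\<close>)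
    qed auto
    also have "ball 0 d - cball (0::'a) y = ball 0 d - cball 0 y \<inter> ball 0 d" by auto
    also have "emeasure lborel \<dots> = emeasure lborel (ball (0::'a) d) - emeasure lborel (cball (0::'a) y \<inter> ball 0 d)"
      proof (rule emeasure_Diff)
      have "emeasure lborel (cball (0::'a) y \<inter> ball 0 d) \<le> emeasure lborel (ball (0::'a) d)"
        by (rule emeasure_mono) auto
      also have "\<dots> < \<infinity>" by (simp add: emeasure_ball assms)
      finally show "emeasure lborel (cball (0::'a) y \<inter> ball 0 d) \<noteq> \<infinity>" by simp
    qed auto
    also have "emeasure lborel (cball (0::'a) y \<inter> ball 0 d) = emeasure lborel (ball (0::'a) y)"
    proof (cases "y = d")
      case True
      then have "cball (0::'a) y \<inter> ball 0 d = ball 0 y" by auto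
      then show ?thesis by simp
    next
      case False
      then have "cball (0::'a) y \<inter> ball 0 d = cball 0 y" using y by (auto simp: dist_norm)
      then show ?thesis using y by (simp add: emeasure_ball emeasure_cball)
    qed
    also have "emeasure lborel (ball (0::'a) d) - emeasure lborel (ball (0::'a) y) = ennreal (?V * (d ^ ?n - y ^ ?n))"
      using y assms by (simp add: emeasure_ball ennreal_minus right_diff_distrib)
    finally show ?thesis by (simp add: y_def)
  qed
  show "emeasure ?M {x<..} < \<infinity>" for x
    by (simp add: tail_M)
  show "emeasure ?M {x<..} = emeasure ?N {x<..}" for x
  proof -
    define y where "y = min (max x 0) d"
    have y: "0 \<le> y" "y \<le> d" using assms by (auto simp: y_def)
    have "emeasure ?N {x<..} = (\<integral>\<^sup>+r. ennreal (?n * ?V * r ^ (?n - 1) * indicator {0..d} r) * indicator {x<..} r \<partial>lborel)"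
      by (subst emeasure_density) auto
    also have "\<dots> = (\<integral>\<^sup>+r. ennreal (?n * ?V * r ^ (?n - 1)) * indicator {y..d} r \<partial>lborel)"
    proof (rule nn_integral_cong_AE)
      \<comment> \<open>Only endpoints distinguish the open half-line from the closed interval:
        \<open>r = x\<close>, and \<open>r = d\<close> when \<open>x\<close> is at least
        \<open>d\<close>.\<close>
      have "AE r in lborel. r \<noteq> x" using AE_lborel_singleton by blast
      moreover have "AE r in lborel. r \<noteq> d" using AE_lborel_singleton by blast
      ultimately show "AE r in lborel. ennreal (?n * ?V * r ^ (?n - 1) * indicator {0..d} r) * indicator {x<..} r = ennreal (?n * ?V * r ^ (?n - 1)) * indicator {y..d} r"
        by eventually_elim (auto simp: y_def indicator_def min_def max_def split: if_splits)
    qed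
    also have "\<dots> = ennreal (?V * d ^ ?n - ?V * y ^ ?n)"
    proof (rule nn_integral_FTC_Icc)
      show "((\<lambda>r. ?V * r ^ ?n) has_real_derivative ?n * ?V * r ^ (?n - 1)) (at r)" for r
        by (auto intro!: derivative_eq_intros)
    qed (use y in auto)
    finally show ?thesis by (simp add: tail_M y_def right_diff_distrib)
  qed
qed auto

lemma integral_radial:
  fixes \<phi> :: "real \<Rightarrow> real"
  assumes [measurable]: "\<phi> \<in> borel_measurable borel" and "0 \<le> d"
  shows "(\<integral>h. indicator (ball (0::'a::euclidean_space) d) h * \<phi> (norm h) \<partial>lborel) =
    real DIM('a) * unit_ball_vol (real DIM('a)) * (\<integral>r. indicator {0..d} r * (r ^ (DIM('a) - 1) * \<phi> r) \<partial>lborel)"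
proof -
  have "(\<integral>(h::'a). indicator (ball 0 d) h * \<phi> (norm h) \<partial>lborel) =
      (\<integral>h. \<phi> (norm h) \<partial>density lborel (\<lambda>h. ennreal (indicator (ball (0::'a) d) h)))"
    by (subst integral_density) (simp_all add: borel_measurable_indicator)
  also have "\<dots> = (\<integral>r. \<phi> r \<partial>distr (density lborel (indicator (ball (0::'a) d))) borel norm)"
    by (subst integral_distr) (auto simp: ennreal_indicator)
  also have "\<dots> = (\<integral>r. (real DIM('a) * unit_ball_vol (real DIM('a)) * r ^ (DIM('a) - 1) * indicator {0..d} r) * \<phi> r \<partial>lborel)"
    unfolding distr_norm_lborel_ball[OF assms(2)]
    by (subst integral_density) (auto simp: indicator_def)
  finally show ?thesis
    by (simp add: mult.assoc mult.left_commute flip: integral_mult_right_zero)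
qed

section \<open>The power kernel cut off to an annulus\<close>

text \<open>The half-open range of \<open>r\<close> matches the difference of the complements of two
  open balls, the sets over which \<open>F_trunc\<close> integrates.\<close>

definition annulus_weight :: "real \<Rightarrow> real \<Rightarrow> real \<Rightarrow> real \<Rightarrow> real" where
  "annulus_weight p e d r = (if e \<le> r \<and> r < d then r powr - p else 0)"

lemma annulus_weight_measurable [measurable]: "annulus_weight p e d \<in> borel_measurable borel"
  unfolding annulus_weight_def by measurable

lemma annulus_weight_nonneg: "0 \<le> annulus_weight p e d r"
  by (simp add: annulus_weight_def)

text \<open>In polar form the integrand is \<open>r ^ (n - 1) * r powr - (n + \<alpha>) * r\<^sup>2
  = r powr (1 - \<alpha>)\<close>, with antiderivative
  \<open>r powr (2 - \<alpha>) / (2 - \<alpha>)\<close>. This is the source of the factor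
  \<open>1 / (2 - \<alpha>)\<close> that the normalization constant compensates.\<close>

lemma integral_annulus_weight_sq:
  assumes "0 < e" "e < d" "\<alpha> < 2"
  shows "(\<integral>(h::'a::euclidean_space). annulus_weight (real DIM('a) + \<alpha>) e d (norm h) * (norm h)\<^sup>2 \<partial>lborel) =
    real DIM('a) * unit_ball_vol (real DIM('a)) * ((d powr (2 - \<alpha>) - e powr (2 - \<alpha>)) / (2 - \<alpha>))"
proof -
  let ?w = "annulus_weight (real DIM('a) + \<alpha>) e d"
  have "(\<integral>(h::'a). ?w (norm h) * (norm h)\<^sup>2 \<partial>lborel) = (\<integral>(h::'a). indicator (ball 0 d) h * (?w (norm h) * (norm h)\<^sup>2) \<partial>lborel)"
    by (rule Bochner_Integration.integral_cong) (auto simp: annulus_weight_def indicator_def)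
  also have "\<dots> = real DIM('a) * unit_ball_vol (real DIM('a)) * (\<integral>r. indicator {0..d} r * (r ^ (DIM('a) - 1) * (?w r * r\<^sup>2)) \<partial>lborel)"
    using assms by (subst integral_radial) auto
  also have "(\<integral>r. indicator {0..d} r * (r ^ (DIM('a) - 1) * (?w r * r\<^sup>2)) \<partial>lborel) = (\<integral>r. r powr (1 - \<alpha>) * indicator {e..d} r \<partial>lborel)"
  proof (rule integral_cong_AE)
    have "AE r in lborel. r \<noteq> d" using AE_lborel_singleton by blast
    then show "AE r in lborel. indicator {0..d} r * (r ^ (DIM('a) - 1) * (?w r * r\<^sup>2)) = r powr (1 - \<alpha>) * indicator {e..d} r"
    proof eventually_elim
      case (elim r)
      show ?case
      proof (cases "e \<le> r \<and> r < d")
        case True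
        then have "0 < r" using assms by linarith
        have "r ^ (DIM('a) - 1) * (r powr - (real DIM('a) + \<alpha>) * r\<^sup>2) = r powr (real (DIM('a) - 1)) * (r powr - (real DIM('a) + \<alpha>) * r powr 2)"
          using \<open>0 < r\<close> by (simp only: powr_realpow powr_numeral)
        also have "\<dots> = r powr (1 - \<alpha>)"
          by (simp add: powr_add[symmetric] of_nat_diff Suc_leI)
        finally show ?thesis using True \<open>0 < r\<close> by (simp add: annulus_weight_def indicator_def)
      next
        case False
        then show ?thesis using elim by (auto simp: annulus_weight_def indicator_def)
      qed
    qed
  qed auto
  also have "\<dots> = d powr (2 - \<alpha>) / (2 - \<alpha>) - e powr (2 - \<alpha>) / (2 - \<alpha>)"
  proof (rule integral_FTC_Icc_real)
    show "((\<lambda>r. r powr (2 - \<alpha>) / (2 - \<alpha>)) has_real_derivative r powr (1 - \<alpha>)) (at r)" if "e \<le> r" "r \<le> d" for r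
      using that assms by (auto intro!: derivative_eq_intros)
    show "isCont (\<lambda>r. r powr (1 - \<alpha>)) r" if "e \<le> r" "r \<le> d" for r
      using that assms by (auto intro!: continuous_intros)
  qed (use assms in auto)
  finally show ?thesis by (simp add: diff_divide_distrib)
qed

lemma integrable_annulus_weight:
  fixes f :: "'a::euclidean_space \<Rightarrow> real"
  assumes "0 < e" "0 \<le> p" "continuous_on UNIV f"
  shows "integrable lborel (\<lambda>h. annulus_weight p e d (norm h) * f h)"
proof -
  have "bounded (f ` cball 0 d)"
    using assms(3) by (intro compact_imp_bounded compact_continuous_image) (auto intro: continuous_on_subset)
  then obtain B where "\<forall>y\<in>f ` cball 0 d. norm y \<le> B"
    unfolding bounded_iff by blast
  then have B: "\<And>h. h \<in> cball 0 d \<Longrightarrow> norm (f h) \<le> B"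
    by blast
  have [measurable]: "f \<in> borel_measurable borel"
    using assms(3) by (rule borel_measurable_continuous_onI)
  show ?thesis
  proof (rule integrableI_bounded_set[where A = "cball 0 d" and B = "e powr - p * B"])
    show "AE h in lborel. h \<in> cball 0 d \<longrightarrow> norm (annulus_weight p e d (norm h) * f h) \<le> e powr - p * B"
    proof (intro AE_I2 impI)
      fix h :: 'a assume h: "h \<in> cball 0 d"
      have "\<bar>annulus_weight p e d (norm h)\<bar> \<le> e powr - p"
        using assms by (auto simp: annulus_weight_def intro: powr_mono2')
      then show "norm (annulus_weight p e d (norm h) * f h) \<le> e powr - p * B"
        using B[OF h] by (auto simp: abs_mult intro!: mult_mono)
    qed
    show "AE h in lborel. h \<notin> cball 0 d \<longrightarrow> annulus_weight p e d (norm h) * f h = 0"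
      by (auto simp: annulus_weight_def)
    show "emeasure lborel (cball (0::'a) d) < \<infinity>"
      by (rule emeasure_lborel_cball_finite)
  qed auto
qed

section \<open>Invariance under sign changes and permutations of coordinates\<close>

text \<open>Lebesgue measure is determined by its values on open boxes. The preimage of a box is
  again a box: in each flipped coordinate the interval from \<open>l $ i\<close> to
  \<open>u $ i\<close> becomes the one from \<open>- u $ i\<close> to \<open>- l $ i\<close>, of
  equal length.\<close>

lemma lborel_distr_signs:
  fixes s :: "'n::finite \<Rightarrow> real"
  assumes "\<And>i. \<bar>s i\<bar> = 1"
  shows "distr lborel borel (\<lambda>h::real^'n. \<chi> i. s i * h $ i) = lborel"
proof (rule lborel_eqI[symmetric])
  fix l u :: "real^'n" assume le: "\<And>b. b \<in> Basis \<Longrightarrow> l \<bullet> b \<le> u \<bullet> b"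
  let ?a = "\<chi> i. if s i = 1 then l $ i else - u $ i" and ?b = "\<chi> i. if s i = 1 then u $ i else - l $ i"
  have s: "s i = 1 \<or> s i = -1" for i using assms[of i] by auto
  have le': "l $ i \<le> u $ i" for i
    using le[of "axis i 1"] by (auto simp: Basis_vec_def inner_axis)
  have m [measurable]: "(\<lambda>h::real^'n. \<chi> i. s i * h $ i) \<in> borel_measurable borel"
    by (intro borel_measurable_continuous_onI continuous_intros)
  have "(\<lambda>h::real^'n. \<chi> i. s i * h $ i) -` box l u = box ?a ?b"
  proof -
    have "l $ i < s i * h $ i \<and> s i * h $ i < u $ i \<longleftrightarrow> ?a $ i < h $ i \<and> h $ i < ?b $ i" for h :: "real^'n" and i
      using s[of i] by auto
    then show ?thesis by (simp add: set_eq_iff mem_box_cart)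
  qed
  then have "emeasure (distr lborel borel (\<lambda>h::real^'n. \<chi> i. s i * h $ i)) (box l u) = emeasure lborel (box ?a ?b)"
    by (simp add: emeasure_distr)
  also have "\<dots> = ennreal (\<Prod>b\<in>Basis. (?b - ?a) \<bullet> b)"
    using le' by (subst emeasure_lborel_box) (auto simp: Basis_vec_def inner_axis)
  also have "(\<Prod>b\<in>Basis. (?b - ?a) \<bullet> b) = (\<Prod>b\<in>Basis. (u - l) \<bullet> b)"
    by (intro prod.cong) (auto simp: Basis_vec_def inner_axis)
  finally show "emeasure (distr lborel borel (\<lambda>h::real^'n. \<chi> i. s i * h $ i)) (box l u) = ennreal (\<Prod>b\<in>Basis. (u - l) \<bullet> b)" .
qed simp

text \<open>The preimage of a box has the same side lengths in another order, so the product giving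
  its volume is unchanged.\<close>

lemma lborel_distr_permute:
  fixes p :: "'n::finite \<Rightarrow> 'n"
  assumes "bij p"
  shows "distr lborel borel (\<lambda>h::real^'n. \<chi> i. h $ p i) = lborel"
proof (rule lborel_eqI[symmetric])
  fix l u :: "real^'n" assume le: "\<And>b. b \<in> Basis \<Longrightarrow> l \<bullet> b \<le> u \<bullet> b"
  let ?a = "\<chi> i. l $ inv p i" and ?b = "\<chi> i. u $ inv p i"
  have m [measurable]: "(\<lambda>h::real^'n. \<chi> i. h $ p i) \<in> borel_measurable borel"
    by (intro borel_measurable_continuous_onI continuous_intros)
  have p: "p (inv p i) = i" "inv p (p i) = i" for i
    using assms by (simp_all add: bij_is_surj surj_f_inv_f bij_is_inj)
  have pre: "(\<lambda>h::real^'n. \<chi> i. h $ p i) -` box l u = box ?a ?b"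
    by (auto simp: mem_box_cart) (metis p)+
  have le': "l $ i \<le> u $ i" for i
    using le[of "axis i 1"] by (auto simp: Basis_vec_def inner_axis)
  \<comment> \<open>Written over coordinates instead of basis vectors, the product can be reindexed
    by \<open>p\<close>.\<close>
  have P: "(\<Prod>b\<in>Basis. v \<bullet> b) = (\<Prod>i\<in>UNIV. v $ i)" for v :: "real^'n"
    by (rule prod.reindex_bij_witness[where i="\<lambda>i. axis i 1" and j="\<lambda>b. THE i. b = axis i 1"])
      (auto simp: Basis_vec_def inner_axis axis_eq_axis)
  have "emeasure (distr lborel borel (\<lambda>h::real^'n. \<chi> i. h $ p i)) (box l u) = emeasure lborel (box ?a ?b)"
    using pre by (simp add: emeasure_distr)
  also have "\<dots> = ennreal (\<Prod>b\<in>Basis. (?b - ?a) \<bullet> b)"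
    using le' by (subst emeasure_lborel_box) (auto simp: Basis_vec_def inner_axis)
  also have "(\<Prod>b\<in>Basis. (?b - ?a) \<bullet> b) = (\<Prod>b\<in>Basis. (u - l) \<bullet> b)"
    unfolding P by (rule prod.reindex_bij_witness[where i=p and j="inv p"]) (auto simp: p)
  finally show "emeasure (distr lborel borel (\<lambda>h::real^'n. \<chi> i. h $ p i)) (box l u) = ennreal (\<Prod>b\<in>Basis. (u - l) \<bullet> b)" .
qed simp

lemma integral_lborel_signs:
  fixes f :: "real^'n \<Rightarrow> real"
  assumes "\<And>i. \<bar>s i\<bar> = 1" and [measurable]: "f \<in> borel_measurable borel"
  shows "(\<integral>h. f (\<chi> i. s i * h $ i) \<partial>lborel) = (\<integral>h. f h \<partial>lborel)"
proof -
  have [measurable]: "(\<lambda>h::real^'n. \<chi> i. s i * h $ i) \<in> borel_measurable borel"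
    by (intro borel_measurable_continuous_onI continuous_intros)
  show ?thesis
    by (subst (2) lborel_distr_signs[of s, OF assms(1), symmetric]) (simp add: integral_distr)
qed

lemma integral_lborel_permute:
  fixes f :: "real^'n \<Rightarrow> real" and p :: "'n \<Rightarrow> 'n"
  assumes "bij p" and [measurable]: "f \<in> borel_measurable borel"
  shows "(\<integral>h. f (\<chi> i. h $ p i) \<partial>lborel) = (\<integral>h. f h \<partial>lborel)"
proof -
  have [measurable]: "(\<lambda>h::real^'n. \<chi> i. h $ p i) \<in> borel_measurable borel"
    by (intro borel_measurable_continuous_onI continuous_intros)
  show ?thesis
    by (subst (2) lborel_distr_permute[OF assms(1), symmetric]) (simp add: integral_distr)
qed

lemma norm_signs:
  assumes "\<And>i. \<bar>s i\<bar> = 1"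
  shows "norm (\<chi> i. s i * (h::real^'n) $ i) = norm h"
  unfolding norm_vec_def L2_set_def by (simp add: abs_mult assms)

lemma norm_permute: "bij p \<Longrightarrow> norm (\<chi> i. (h::real^'n) $ p i) = norm h"
  unfolding norm_vec_def L2_set_def
  by (simp add: sum.reindex_bij_betw[of p UNIV UNIV "\<lambda>i. (h $ i)\<^sup>2"])

section \<open>First and second moments of radial weights\<close>

text \<open>The reflection \<open>h \<mapsto> - h\<close> preserves the weight and reverses the
  linear factor, so the integral equals its own negative.\<close>

lemma integral_radial_linear:
  fixes \<phi> :: "real \<Rightarrow> real" and v :: "real^'n"
  assumes [measurable]: "\<phi> \<in> borel_measurable borel"
  shows "(\<integral>h. \<phi> (norm h) * (v \<bullet> h) \<partial>lborel) = 0"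
proof -
  have "(\<integral>h. \<phi> (norm h) * (v \<bullet> h) \<partial>lborel) = (\<integral>h. \<phi> (norm (\<chi> i. - 1 * h $ i)) * (v \<bullet> (\<chi> i. - 1 * h $ i)) \<partial>lborel)"
    by (rule integral_lborel_signs[symmetric]) auto
  also have "\<dots> = - (\<integral>h. \<phi> (norm h) * (v \<bullet> h) \<partial>lborel)"
    by (subst norm_signs) (simp_all add: inner_vec_def sum_negf)
  finally show ?thesis by simp
qed

text \<open>Flipping the sign of coordinate \<open>i\<close> alone reverses the sign of the
  integrand.\<close>

lemma integral_radial_mixed:
  fixes \<phi> :: "real \<Rightarrow> real" and i j :: "'n::finite"
  assumes [measurable]: "\<phi> \<in> borel_measurable borel" and "i \<noteq> j"
  shows "(\<integral>(h::real^'n). \<phi> (norm h) * (h $ i * h $ j) \<partial>lborel) = 0"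
proof -
  let ?s = "\<lambda>k. if k = i then - 1 else 1 :: real"
  have "(\<integral>(h::real^'n). \<phi> (norm h) * (h $ i * h $ j) \<partial>lborel) =
      (\<integral>(h::real^'n). \<phi> (norm (\<chi> k. ?s k * h $ k)) * ((\<chi> k. ?s k * h $ k) $ i * (\<chi> k. ?s k * h $ k) $ j) \<partial>lborel)"
    by (rule integral_lborel_signs[symmetric]) auto
  also have "\<dots> = (\<integral>(h::real^'n). - (\<phi> (norm h) * (h $ i * h $ j)) \<partial>lborel)"
    using assms(2) by (subst norm_signs) auto
  finally show ?thesis by simp
qed

text \<open>Swapping the coordinates \<open>i\<close> and \<open>j\<close> preserves the norm and
  exchanges the two integrands.\<close>

lemma integral_radial_square:
  fixes \<phi> :: "real \<Rightarrow> real" and i j :: "'n::finite"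
  assumes [measurable]: "\<phi> \<in> borel_measurable borel"
  shows "(\<integral>(h::real^'n). \<phi> (norm h) * (h $ i * h $ i) \<partial>lborel) = (\<integral>(h::real^'n). \<phi> (norm h) * (h $ j * h $ j) \<partial>lborel)"
proof -
  have b: "bij (Transposition.transpose i j)" by simp
  have "(\<integral>(h::real^'n). \<phi> (norm h) * (h $ i * h $ i) \<partial>lborel) =
     (\<integral>(h::real^'n). \<phi> (norm (\<chi> k. h $ Transposition.transpose i j k)) *
      ((\<chi> k. h $ Transposition.transpose i j k) $ i * (\<chi> k. h $ Transposition.transpose i j k) $ i) \<partial>lborel)"
    by (rule integral_lborel_permute[symmetric]) (auto simp: b)
  also have "\<dots> = (\<integral>(h::real^'n). \<phi> (norm h) * (h $ j * h $ j) \<partial>lborel)"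
    by (simp only: norm_permute[OF b]) simp
  finally show ?thesis .
qed

text \<open>Off-diagonal moments vanish and the diagonal ones agree. Since the latter add up to the
  moment of \<open>(norm h)\<^sup>2\<close>, each is its \<open>n\<close>-th part, and only the
  trace of \<open>A\<close> survives.\<close>

lemma integral_radial_quadratic:
  fixes \<phi> :: "real \<Rightarrow> real" and A :: "'n::finite \<Rightarrow> 'n \<Rightarrow> real"
  assumes [measurable]: "\<phi> \<in> borel_measurable borel"
    and int: "\<And>i j. integrable lborel (\<lambda>h::real^'n. \<phi> (norm h) * (h $ i * h $ j))"
  shows "(\<integral>(h::real^'n). \<phi> (norm h) * (\<Sum>i\<in>UNIV. \<Sum>j\<in>UNIV. A i j * (h $ i * h $ j)) \<partial>lborel) =
    (\<Sum>i\<in>UNIV. A i i) * ((\<integral>(h::real^'n). \<phi> (norm h) * (norm h)\<^sup>2 \<partial>lborel) / real CARD('n))"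
proof -
  define m where "m i = (\<integral>(h::real^'n). \<phi> (norm h) * (h $ i * h $ i) \<partial>lborel)" for i
  have "(\<integral>(h::real^'n). \<phi> (norm h) * (norm h)\<^sup>2 \<partial>lborel) = (\<integral>(h::real^'n). (\<Sum>i\<in>UNIV. \<phi> (norm h) * (h $ i * h $ i)) \<partial>lborel)"
    by (simp add: power2_norm_eq_inner inner_vec_def sum_distrib_left)
  also have "\<dots> = (\<Sum>i\<in>UNIV. m i)"
    unfolding m_def by (intro Bochner_Integration.integral_sum int)
  also have "\<dots> = real CARD('n) * m k" for k
  proof -
    have "(\<Sum>i\<in>UNIV. m i) = (\<Sum>i\<in>(UNIV :: 'n set). m k)"
      unfolding m_def by (intro sum.cong refl integral_radial_square assms)
    then show ?thesis by simp
  qed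
  finally have m: "m k = (\<integral>(h::real^'n). \<phi> (norm h) * (norm h)\<^sup>2 \<partial>lborel) / real CARD('n)" for k
    by (simp add: field_simps)
  have "(\<integral>(h::real^'n). \<phi> (norm h) * (\<Sum>i\<in>UNIV. \<Sum>j\<in>UNIV. A i j * (h $ i * h $ j)) \<partial>lborel) =
      (\<integral>(h::real^'n). (\<Sum>i\<in>UNIV. \<Sum>j\<in>UNIV. A i j * (\<phi> (norm h) * (h $ i * h $ j))) \<partial>lborel)"
    by (simp add: sum_distrib_left mult.left_commute)
  also have "\<dots> = (\<Sum>i\<in>UNIV. \<Sum>j\<in>UNIV. A i j * (\<integral>(h::real^'n). \<phi> (norm h) * (h $ i * h $ j) \<partial>lborel))"
    by (simp add: int)
  also have "\<dots> = (\<Sum>i\<in>UNIV. \<Sum>j\<in>UNIV. if i = j then A i i * m i else 0)"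
    by (intro sum.cong refl) (auto simp: m_def integral_radial_mixed)
  also have "\<dots> = (\<Sum>i\<in>UNIV. A i i) * ((\<integral>(h::real^'n). \<phi> (norm h) * (norm h)\<^sup>2 \<partial>lborel) / real CARD('n))"
    by (simp add: m sum_distrib_right sum_divide_distrib)
  finally show ?thesis .
qed

section \<open>Second-order expansion of the composed difference\<close>

lemma second_order_taylor:
  fixes f :: "'a::real_inner \<Rightarrow> real" and g D :: "'a \<Rightarrow> 'a"
  assumes f: "\<And>y. (f has_derivative (\<lambda>h. g y \<bullet> h)) (at y)"
    and g: "(g has_derivative D) (at x)" and "0 < \<eta>"
  shows "\<exists>\<rho>>0. \<forall>h. norm h < \<rho> \<longrightarrow> \<bar>f (x + h) - f x - g x \<bullet> h - (D h \<bullet> h) / 2\<bar> \<le> \<eta> * (norm h)\<^sup>2"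
proof -
  obtain \<rho> where "0 < \<rho>" and \<rho>: "\<And>y. norm (y - x) < \<rho> \<Longrightarrow> norm (g y - g x - D (y - x)) \<le> \<eta> * norm (y - x)"
    using g \<open>0 < \<eta>\<close> unfolding has_derivative_at_alt by blast
  interpret D: bounded_linear D using g by (rule has_derivative_bounded_linear)
  have "\<bar>f (x + h) - f x - g x \<bullet> h - (D h \<bullet> h) / 2\<bar> \<le> \<eta> * (norm h)\<^sup>2" if h: "norm h < \<rho>" for h
  proof -
    \<comment> \<open>The increment of this function from 0 to 1 is exactly the remainder to be
      estimated.\<close>
    let ?\<phi> = "\<lambda>t. f (x + t *\<^sub>R h) - t * (g x \<bullet> h) - t\<^sup>2 / 2 * (D h \<bullet> h)"
    let ?\<phi>' = "\<lambda>t d. d * ((g (x + t *\<^sub>R h) - g x - t *\<^sub>R D h) \<bullet> h)"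
    have comp: "((\<lambda>t. f (x + t *\<^sub>R h)) has_derivative (\<lambda>d. g (x + t *\<^sub>R h) \<bullet> (d *\<^sub>R h))) (at t)" for t
      by (rule has_derivative_compose[OF _ f]) (auto intro!: derivative_eq_intros)
    have der: "(?\<phi> has_derivative ?\<phi>' t) (at t)" for t
      by (rule derivative_eq_intros comp refl)+ (auto simp: fun_eq_iff algebra_simps inner_simps)
    have "continuous_on {0..1} ?\<phi>"
      using der by (intro continuous_at_imp_continuous_on ballI has_derivative_continuous) blast
    then obtain t where t: "0 < t" "t < 1" and le: "norm (?\<phi> 1 - ?\<phi> 0) \<le> norm (?\<phi>' t (1 - 0))"
      using mvt_general[of 0 1 ?\<phi> ?\<phi>'] der by force
    have "norm (t *\<^sub>R h) \<le> norm h"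
      using t by (simp add: mult_left_le_one_le)
    with h have "norm (g (x + t *\<^sub>R h) - g x - t *\<^sub>R D h) \<le> \<eta> * norm (t *\<^sub>R h)"
      using \<rho>[of "x + t *\<^sub>R h"] by (simp add: D.scaleR)
    also have "\<dots> \<le> \<eta> * norm h"
      using \<open>norm (t *\<^sub>R h) \<le> norm h\<close> \<open>0 < \<eta>\<close> by (intro mult_left_mono) auto
    finally have "norm (g (x + t *\<^sub>R h) - g x - t *\<^sub>R D h) * norm h \<le> \<eta> * (norm h)\<^sup>2"
      by (simp add: power2_eq_square mult_right_mono flip: mult.assoc)
    then have "\<bar>(g (x + t *\<^sub>R h) - g x - t *\<^sub>R D h) \<bullet> h\<bar> \<le> \<eta> * (norm h)\<^sup>2"
      using Cauchy_Schwarz_ineq2 order_trans by blast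
    with le show ?thesis by (simp add: algebra_simps)
  qed
  with \<open>0 < \<rho>\<close> show ?thesis by blast
qed

lemma partial_deriv_eq:
  assumes "(u has_derivative u') (at x)"
  shows "partial_deriv i u x = u' (axis i 1)"
proof -
  have "((\<lambda>t. u (x + t *\<^sub>R axis i 1)) has_derivative (\<lambda>d. u' (d *\<^sub>R axis i 1))) (at 0)"
    by (rule has_derivative_compose[where f="\<lambda>t. x + t *\<^sub>R axis i 1"]) (use assms in \<open>auto intro!: derivative_eq_intros\<close>)
  moreover have "u' (d *\<^sub>R axis i 1) = u' (axis i 1) * d" for d
    using linear_scale[OF has_derivative_linear[OF assms]] by simp
  ultimately have "((\<lambda>t. u (x + t *\<^sub>R axis i 1)) has_real_derivative u' (axis i 1)) (at 0)"
    by (simp add: has_field_derivative_def)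
  then show ?thesis unfolding partial_deriv_def by (rule DERIV_imp_deriv)
qed

lemma has_derivative_grad:
  fixes u :: "real^'n \<Rightarrow> real"
  assumes "u differentiable (at x)"
  shows "(u has_derivative (\<lambda>h. grad u x \<bullet> h)) (at x)"
proof -
  obtain u' where u': "(u has_derivative u') (at x)" using assms by (auto simp: differentiable_def)
  then interpret u': bounded_linear u' by (rule has_derivative_bounded_linear)
  have "u' h = grad u x \<bullet> h" for h
  proof -
    have "u' h = u' (\<Sum>i\<in>UNIV. (h $ i) *\<^sub>R axis i 1)"
      by (simp add: basis_expansion flip: scalar_mult_eq_scaleR)
    then show ?thesis
      by (simp add: u'.sum u'.scaleR grad_def partial_deriv_eq[OF u'] inner_vec_def mult.commute)
  qed
  then have "u' = (\<lambda>h. grad u x \<bullet> h)" ..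
  with u' show ?thesis by simp
qed

text \<open>Each first partial derivative is a coordinate of \<open>grad u\<close>, hence
  differentiable at \<open>x\<close>. The iterated partial derivatives are then diagonal entries of
  \<open>D\<close>, and the Laplacian is its trace.\<close>

lemma laplacian_eq:
  fixes u :: "real^'n \<Rightarrow> real"
  assumes "(grad u has_derivative D) (at x)"
  shows "laplacian u x = (\<Sum>i\<in>UNIV. D (axis i 1) $ i)"
proof -
  have *: "(partial_deriv i u has_derivative (\<lambda>h. D h $ i)) (at x)" for i
  proof -
    have "((\<lambda>y. grad u y $ i) has_derivative (\<lambda>h. D h $ i)) (at x)"
      using assms by (rule bounded_linear.has_derivative[OF bounded_linear_vec_nth])
    then show ?thesis by (simp add: grad_def)
  qed
  then show ?thesis unfolding laplacian_def by (simp add: partial_deriv_eq[OF *])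
qed

text \<open>The two conclusions supply the two hypotheses of \<open>second_order_taylor\<close>: a
  gradient at every point, and the derivative of that gradient at 0. In the second, the minus sign
  of the gradient meets the minus sign from differentiating \<open>u x - u (x + h)\<close>, so the
  \<open>G''(0)\<close> term is positive while the \<open>G'(0)\<close> term stays negative.\<close>

lemma has_derivative_difference_gradient:
  fixes u :: "real^'n \<Rightarrow> real"
  assumes u: "\<And>y. u differentiable (at y)" and D: "(grad u has_derivative D) (at x)"
    and G: "\<And>t. G differentiable (at t)" "\<And>t. deriv G differentiable (at t)"
  shows "((\<lambda>h. G (u x - u (x + h))) has_derivative (\<lambda>k. (- deriv G (u x - u (x + h)) *\<^sub>R grad u (x + h)) \<bullet> k)) (at h)"
    and "((\<lambda>h. - deriv G (u x - u (x + h)) *\<^sub>R grad u (x + h)) has_derivative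
      (\<lambda>k. (deriv (deriv G) 0 * (grad u x \<bullet> k)) *\<^sub>R grad u x - deriv G 0 *\<^sub>R D k)) (at 0)"
proof -
  have diff: "((\<lambda>h. u x - u (x + h)) has_derivative (\<lambda>k. - (grad u (x + h) \<bullet> k))) (at h)" for h
  proof -
    have "((\<lambda>h. u (x + h)) has_derivative (\<lambda>k. grad u (x + h) \<bullet> k)) (at h)"
      by (rule has_derivative_compose[OF _ has_derivative_grad[OF u]]) (auto intro!: derivative_eq_intros)
    then show ?thesis by (auto intro!: derivative_eq_intros)
  qed
  have DG: "(G has_derivative (\<lambda>d. deriv G t * d)) (at t)" for t
    using G(1)[of t] by (simp add: DERIV_deriv_iff_real_differentiable flip: has_field_derivative_def)
  have DDG: "(deriv G has_derivative (\<lambda>d. deriv (deriv G) t * d)) (at t)" for t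
    using G(2)[of t] by (simp add: DERIV_deriv_iff_real_differentiable flip: has_field_derivative_def)
  show "((\<lambda>h. G (u x - u (x + h))) has_derivative (\<lambda>k. (- deriv G (u x - u (x + h)) *\<^sub>R grad u (x + h)) \<bullet> k)) (at h)"
    using has_derivative_compose[OF diff DG] by simp
  have 1: "((\<lambda>h. grad u (x + h)) has_derivative D) (at 0)"
    by (rule has_derivative_compose[of "\<lambda>h. x + h" "\<lambda>h. h" 0 UNIV "grad u" D]) (use D in \<open>auto intro!: derivative_eq_intros\<close>)
  have 2: "((\<lambda>h. deriv G (u x - u (x + h))) has_derivative (\<lambda>k. deriv (deriv G) 0 * - (grad u x \<bullet> k))) (at 0)"
    using has_derivative_compose[OF diff[of 0] DDG] by simp
  show "((\<lambda>h. - deriv G (u x - u (x + h)) *\<^sub>R grad u (x + h)) has_derivative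
      (\<lambda>k. (deriv (deriv G) 0 * (grad u x \<bullet> k)) *\<^sub>R grad u x - deriv G 0 *\<^sub>R D k)) (at 0)"
    by (rule derivative_eq_intros 1 2 refl)+ (auto simp: fun_eq_iff)
qed

section \<open>Truncated integrals over annuli\<close>

text \<open>\<open>F_trunc\<close> uses \<open>lebesgue\<close> and is centred at \<open>x\<close>,
  while the moments are computed for \<open>lborel\<close> around 0. Translation invariance and
  passage to the completion connect the two.\<close>

lemma
  fixes f :: "'a::euclidean_space \<Rightarrow> real"
  assumes [measurable]: "f \<in> borel_measurable borel"
  shows integrable_lebesgue_shift: "integrable lborel f \<Longrightarrow> integrable lebesgue (\<lambda>z. f (z - x))"
    and integral_lebesgue_shift: "(\<integral>z. f (z - x) \<partial>lebesgue) = (\<integral>h. f h \<partial>lborel)"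
proof -
  have eq: "distr lborel borel (\<lambda>z. z - x) = (lborel :: 'a measure)"
  proof -
    have "(\<lambda>z. z - x) = (+) (- x)" by (simp add: fun_eq_iff)
    then show ?thesis by (simp add: lborel_distr_plus)
  qed
  show "integrable lebesgue (\<lambda>z. f (z - x))" if "integrable lborel f"
    using that by (subst (asm) eq[symmetric]) (simp add: integrable_distr_eq integrable_completion)
  show "(\<integral>z. f (z - x) \<partial>lebesgue) = (\<integral>h. f h \<partial>lborel)"
    by (subst (2) eq[symmetric]) (simp add: integral_distr integral_completion)
qed

text \<open>Only the trace of the quadratic part contributes. The factor \<open>n\<close> of the
  radial second moment cancels the \<open>1 / n\<close> from averaging over coordinates.\<close>

lemma integral_annulus_polynomial:
  fixes E :: "real^'n \<Rightarrow> real^'n" and b :: "real^'n"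
  assumes E: "linear E" and "0 < e" "e < d" "0 \<le> \<alpha>" "\<alpha> < 2"
  shows "(\<integral>h. annulus_weight (real CARD('n) + \<alpha>) e d (norm h) * (b \<bullet> h + (E h \<bullet> h) / 2) \<partial>lborel) =
    unit_ball_vol (real CARD('n)) * ((\<Sum>i\<in>UNIV. E (axis i 1) $ i) / 2) * ((d powr (2 - \<alpha>) - e powr (2 - \<alpha>)) / (2 - \<alpha>))"
proof -
  let ?w = "annulus_weight (real CARD('n) + \<alpha>) e d"
  have int: "integrable lborel (\<lambda>h::real^'n. ?w (norm h) * f h)" if "continuous_on UNIV f" for f
    using assms that by (intro integrable_annulus_weight) auto
  have contE: "continuous_on UNIV E"
    using E by (simp add: linear_continuous_on linear_linear)
  have expand: "E h \<bullet> h = (\<Sum>i\<in>UNIV. \<Sum>j\<in>UNIV. E (axis j 1) $ i * (h $ i * h $ j))" for h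
  proof -
    have "E h = E (\<Sum>j\<in>UNIV. (h $ j) *\<^sub>R axis j 1)"
      by (simp add: basis_expansion flip: scalar_mult_eq_scaleR)
    also have "\<dots> = (\<Sum>j\<in>UNIV. (h $ j) *\<^sub>R E (axis j 1))"
      by (simp add: linear_sum[OF E] linear_scale[OF E])
    finally show ?thesis
      by (simp add: inner_vec_def sum_distrib_right sum_distrib_left mult_ac)
  qed
  have "(\<integral>h. ?w (norm h) * (b \<bullet> h + (E h \<bullet> h) / 2) \<partial>lborel) =
      (\<integral>h. ?w (norm h) * (b \<bullet> h) + ?w (norm h) * (E h \<bullet> h) / 2 \<partial>lborel)"
    by (simp add: distrib_left)
  also have "\<dots> = (\<integral>h. ?w (norm h) * (b \<bullet> h) \<partial>lborel) + (\<integral>h. ?w (norm h) * (E h \<bullet> h) \<partial>lborel) / 2"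
    by (subst Bochner_Integration.integral_add) (auto intro!: int continuous_intros contE)
  also have "(\<integral>h. ?w (norm h) * (b \<bullet> h) \<partial>lborel) = 0"
    by (rule integral_radial_linear) simp
  also have "(\<integral>h. ?w (norm h) * (E h \<bullet> h) \<partial>lborel) = (\<Sum>i\<in>UNIV. E (axis i 1) $ i) *
      ((\<integral>(h::real^'n). ?w (norm h) * (norm h)\<^sup>2 \<partial>lborel) / real CARD('n))"
    unfolding expand by (rule integral_radial_quadratic) (auto intro!: int continuous_intros)
  also have "(\<integral>(h::real^'n). ?w (norm h) * (norm h)\<^sup>2 \<partial>lborel) =
      real CARD('n) * unit_ball_vol (real CARD('n)) * ((d powr (2 - \<alpha>) - e powr (2 - \<alpha>)) / (2 - \<alpha>))"
    using integral_annulus_weight_sq[where 'a = "real^'n", OF assms(2,3,5)] by simp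
  finally show ?thesis by (simp add: mult_ac)
qed

text \<open>Both truncated integrals converge absolutely, so subtracting them leaves the integral
  over the shell between the two spheres.\<close>

lemma F_trunc_difference:
  fixes u :: "real^'n \<Rightarrow> real"
  assumes int: "set_integrable lebesgue (- ball x e) (F_kernel \<alpha> G u x)" and "0 < e" "e < d"
  defines "W \<equiv> \<lambda>z. annulus_weight (real CARD('n) + \<alpha>) e d (norm (z - x)) * G (u x - u z)"
  shows "integrable lebesgue W" "F_trunc \<alpha> G u x e - F_trunc \<alpha> G u x d = (\<integral>z. W z \<partial>lebesgue)"
proof -
  let ?K = "F_kernel \<alpha> G u x"
  have int': "set_integrable lebesgue (- ball x d) ?K"
    by (rule set_integrable_subset[OF int]) (use assms in auto)
  have W: "W z = indicator (- ball x e) z *\<^sub>R ?K z - indicator (- ball x d) z *\<^sub>R ?K z" for z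
    using \<open>e < d\<close>
    by (auto simp: W_def annulus_weight_def F_kernel_def indicator_def dist_norm norm_minus_commute
      powr_minus_divide simp del: minus_add_distrib)
  show "integrable lebesgue W"
    using int int' unfolding W set_integrable_def by (rule Bochner_Integration.integrable_diff)
  show "F_trunc \<alpha> G u x e - F_trunc \<alpha> G u x d = (\<integral>z. W z \<partial>lebesgue)"
    using int int' unfolding W F_trunc_def set_lebesgue_integral_def set_integrable_def
    by (rule Bochner_Integration.integral_diff[symmetric])
qed

text \<open>The Taylor error is at most \<open>\<eta> * (norm h)\<^sup>2\<close> on the annulus, so
  its integral is controlled by the second moment of the weight. Main term and error carry the same
  factor \<open>T\<close>, which keeps the comparison uniform in \<alpha> after multiplication by
  \<open>2 - \<alpha>\<close>.\<close>

lemma F_trunc_difference_bound: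
  fixes u :: "real^'n \<Rightarrow> real" and b :: "real^'n"
  assumes int: "set_integrable lebesgue (- ball x e) (F_kernel \<alpha> G u x)"
    and "0 < e" "e < d" "0 \<le> \<alpha>" "\<alpha> < 2" and E: "linear E"
    and bound: "\<And>h. norm h < d \<Longrightarrow> \<bar>G (u x - u (x + h)) - b \<bullet> h - (E h \<bullet> h) / 2\<bar> \<le> \<eta> * (norm h)\<^sup>2"
  defines "T \<equiv> (d powr (2 - \<alpha>) - e powr (2 - \<alpha>)) / (2 - \<alpha>)"
  shows "\<bar>F_trunc \<alpha> G u x e - F_trunc \<alpha> G u x d - unit_ball_vol (real CARD('n)) * ((\<Sum>i\<in>UNIV. E (axis i 1) $ i) / 2) * T\<bar>
    \<le> \<eta> * (real CARD('n) * unit_ball_vol (real CARD('n)) * T)"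
proof -
  let ?w = "annulus_weight (real CARD('n) + \<alpha>) e d"
  \<comment> \<open>\<open>W\<close> is the true integrand, \<open>P\<close> its Taylor polynomial
    against the kernel, and \<open>S\<close> dominates their difference.\<close>
  define W where "W z = ?w (norm (z - x)) * G (u x - u z)" for z
  define P where "P h = ?w (norm h) * (b \<bullet> h + (E h \<bullet> h) / 2)" for h
  define S where "S h = \<eta> * (?w (norm h) * (norm h)\<^sup>2)" for h :: "real^'n"
  have contE: "continuous_on UNIV E"
    using E by (simp add: linear_continuous_on linear_linear)
  have [measurable]: "E \<in> borel_measurable borel"
    using contE by (rule borel_measurable_continuous_onI)
  have [measurable]: "P \<in> borel_measurable borel" "S \<in> borel_measurable borel"
    unfolding P_def S_def by measurable
  have intP: "integrable lborel P" and intS: "integrable lborel S"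
    unfolding P_def S_def using assms
    by (auto intro!: integrable_mult_right integrable_annulus_weight continuous_intros contE)
  note W = F_trunc_difference[OF int \<open>0 < e\<close> \<open>e < d\<close>, folded W_def]
  have "\<bar>\<integral>z. W z - P (z - x) \<partial>lebesgue\<bar> \<le> (\<integral>z. S (z - x) \<partial>lebesgue)"
  proof (rule integral_abs_bound_integral)
    show "\<bar>W z - P (z - x)\<bar> \<le> S (z - x)" for z
    proof (cases "norm (z - x) < d")
      case True
      have "\<bar>W z - P (z - x)\<bar> = ?w (norm (z - x)) * \<bar>G (u x - u (x + (z - x))) - b \<bullet> (z - x) - (E (z - x) \<bullet> (z - x)) / 2\<bar>"
      proof -
        have "W z - P (z - x) = ?w (norm (z - x)) * (G (u x - u (x + (z - x))) - b \<bullet> (z - x) - (E (z - x) \<bullet> (z - x)) / 2)"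
          by (simp add: W_def P_def right_diff_distrib distrib_left)
        then show ?thesis by (simp only: abs_mult abs_of_nonneg[OF annulus_weight_nonneg])
      qed
      also have "\<dots> \<le> ?w (norm (z - x)) * (\<eta> * (norm (z - x))\<^sup>2)"
        by (intro mult_left_mono bound True annulus_weight_nonneg)
      finally show ?thesis by (simp add: S_def mult_ac)
    qed (simp add: W_def P_def S_def annulus_weight_def)
  qed (auto intro!: W(1) integrable_lebesgue_shift intP intS Bochner_Integration.integrable_diff)
  also have "(\<integral>z. W z - P (z - x) \<partial>lebesgue) = (\<integral>z. W z \<partial>lebesgue) - (\<integral>z. P (z - x) \<partial>lebesgue)"
    by (auto intro!: W(1) integrable_lebesgue_shift intP Bochner_Integration.integral_diff)
  also have "(\<integral>z. P (z - x) \<partial>lebesgue) = (\<integral>h. P h \<partial>lborel)"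
    by (rule integral_lebesgue_shift) simp
  also have "\<dots> = unit_ball_vol (real CARD('n)) * ((\<Sum>i\<in>UNIV. E (axis i 1) $ i) / 2) * T"
    unfolding P_def T_def using assms by (intro integral_annulus_polynomial) auto
  also have "(\<integral>z. S (z - x) \<partial>lebesgue) = (\<integral>h. S h \<partial>lborel)"
    by (rule integral_lebesgue_shift) simp
  also have "\<dots> = \<eta> * (real CARD('n) * unit_ball_vol (real CARD('n)) * T)"
    using integral_annulus_weight_sq[where 'a = "real^'n", OF \<open>0 < e\<close> \<open>e < d\<close> \<open>\<alpha> < 2\<close>]
    by (simp add: S_def T_def)
  finally show ?thesis by (simp add: W(2))
qed

section \<open>Principal values and the limit in \<alpha>\<close>

text \<open>The annulus estimate passes to the limit as the inner radius shrinks to 0. Multiplying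
  by \<open>2 - \<alpha>\<close> then cancels the denominator on both sides.\<close>

lemma principal_value_bound:
  fixes u :: "real^'n \<Rightarrow> real" and b :: "real^'n"
  assumes wd: "F_well_defined \<alpha> G u x"
    and "0 < d" "0 \<le> \<alpha>" "\<alpha> < 2" and E: "linear E"
    and bound: "\<And>h. norm h < d \<Longrightarrow> \<bar>G (u x - u (x + h)) - b \<bullet> h - (E h \<bullet> h) / 2\<bar> \<le> \<eta> * (norm h)\<^sup>2"
  shows "\<bar>(2 - \<alpha>) * Lim (at_right 0) (F_trunc \<alpha> G u x) - (2 - \<alpha>) * F_trunc \<alpha> G u x d -
      unit_ball_vol (real CARD('n)) * ((\<Sum>i\<in>UNIV. E (axis i 1) $ i) / 2) * d powr (2 - \<alpha>)\<bar>
    \<le> \<eta> * (real CARD('n) * unit_ball_vol (real CARD('n)) * d powr (2 - \<alpha>))"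
proof -
  let ?V = "unit_ball_vol (real CARD('n))" and ?q = "(\<Sum>i\<in>UNIV. E (axis i 1) $ i) / 2"
  let ?T = "\<lambda>e. (d powr (2 - \<alpha>) - e powr (2 - \<alpha>)) / (2 - \<alpha>)"
  obtain l where l: "(F_trunc \<alpha> G u x \<longlongrightarrow> l) (at_right 0)"
    using wd by (auto simp: F_well_defined_def)
  then have Lim: "Lim (at_right 0) (F_trunc \<alpha> G u x) = l"
    by (intro tendsto_Lim) auto
  \<comment> \<open>The exponent is positive, so the limit \<open>0 powr (2 - \<alpha>)\<close> is
    0.\<close>
  have pow: "((\<lambda>e. e powr (2 - \<alpha>)) \<longlongrightarrow> 0 powr (2 - \<alpha>)) (at_right 0)"
  proof (rule tendsto_powr2[OF tendsto_ident_at tendsto_const])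
    show "\<forall>\<^sub>F e in at_right 0. (0::real) \<le> e"
      by (rule eventually_mono[OF eventually_at_right_less]) simp
  qed (use \<open>\<alpha> < 2\<close> in simp)
  then have T: "(?T \<longlongrightarrow> d powr (2 - \<alpha>) / (2 - \<alpha>)) (at_right 0)"
    using tendsto_divide[OF tendsto_diff[OF tendsto_const[of "d powr (2 - \<alpha>)"] pow] tendsto_const[of "2 - \<alpha>"]] \<open>\<alpha> < 2\<close>
    by simp
  have "\<forall>\<^sub>F e in at_right 0. \<bar>F_trunc \<alpha> G u x e - F_trunc \<alpha> G u x d - ?V * ?q * ?T e\<bar> \<le> \<eta> * (real CARD('n) * ?V * ?T e)"
    unfolding eventually_at_right_field
  proof (intro exI[of _ d] conjI allI impI)
    fix e :: real assume "0 < e" "e < d"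
    moreover from \<open>0 < e\<close> have "set_integrable lebesgue (- ball x e) (F_kernel \<alpha> G u x)"
      using wd by (auto simp: F_well_defined_def)
    ultimately show "\<bar>F_trunc \<alpha> G u x e - F_trunc \<alpha> G u x d - ?V * ?q * ?T e\<bar> \<le> \<eta> * (real CARD('n) * ?V * ?T e)"
      using assms by (intro F_trunc_difference_bound) auto
  qed (use \<open>0 < d\<close> in auto)
  then have bd: "\<bar>l - F_trunc \<alpha> G u x d - ?V * ?q * (d powr (2 - \<alpha>) / (2 - \<alpha>))\<bar> \<le> \<eta> * (real CARD('n) * ?V * (d powr (2 - \<alpha>) / (2 - \<alpha>)))"
    by (rule tendsto_le[rotated -1]) (simp, (intro tendsto_mult tendsto_diff tendsto_rabs tendsto_const l T)+)
  have cancel: "(2 - \<alpha>) * (a * (y / (2 - \<alpha>))) = a * y" for a y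
    using \<open>\<alpha> < 2\<close> by simp
  from bd have "(2 - \<alpha>) * \<bar>l - F_trunc \<alpha> G u x d - ?V * ?q * (d powr (2 - \<alpha>) / (2 - \<alpha>))\<bar>
      \<le> (2 - \<alpha>) * (\<eta> * (real CARD('n) * ?V * (d powr (2 - \<alpha>) / (2 - \<alpha>))))"
    using \<open>\<alpha> < 2\<close> by (intro mult_left_mono) auto
  also have "(2 - \<alpha>) * \<bar>l - F_trunc \<alpha> G u x d - ?V * ?q * (d powr (2 - \<alpha>) / (2 - \<alpha>))\<bar> =
      \<bar>(2 - \<alpha>) * (l - F_trunc \<alpha> G u x d - ?V * ?q * (d powr (2 - \<alpha>) / (2 - \<alpha>)))\<bar>"
    using \<open>\<alpha> < 2\<close> by (simp add: abs_mult)
  also have "(2 - \<alpha>) * (l - F_trunc \<alpha> G u x d - ?V * ?q * (d powr (2 - \<alpha>) / (2 - \<alpha>))) =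
      (2 - \<alpha>) * l - (2 - \<alpha>) * F_trunc \<alpha> G u x d - ?V * ?q * d powr (2 - \<alpha>)"
    by (simp only: right_diff_distrib cancel)
  also have "(2 - \<alpha>) * (\<eta> * (real CARD('n) * ?V * (d powr (2 - \<alpha>) / (2 - \<alpha>)))) = \<eta> * (real CARD('n) * ?V * d powr (2 - \<alpha>))"
    using \<open>\<alpha> < 2\<close> by simp
  finally show ?thesis by (simp only: Lim)
qed

text \<open>Away from the singularity, the kernel for \<alpha> above a fixed \<beta> is dominated by
  a constant times the kernel for \<beta>, whose integrability comes from well-definedness at
  \<beta>. The truncated integral is thus bounded uniformly in \<alpha>, and the factor
  \<open>2 - \<alpha>\<close> sends it to 0.\<close>

lemma tendsto_F_trunc_tail:
  fixes u :: "real^'n \<Rightarrow> real"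
  assumes wd: "\<forall>\<^sub>F \<alpha> in at_left 2. F_well_defined \<alpha> G u x" and "0 < d" "d \<le> 1"
  shows "((\<lambda>\<alpha>. (2 - \<alpha>) * F_trunc \<alpha> G u x d) \<longlongrightarrow> 0) (at_left 2)"
proof -
  obtain b :: real where "b < 2" and b: "\<And>\<alpha>. b < \<alpha> \<Longrightarrow> \<alpha> < 2 \<Longrightarrow> F_well_defined \<alpha> G u x"
    using wd unfolding eventually_at_left_field by blast
  then obtain \<beta> where \<beta>: "b < \<beta>" "\<beta> < 2" using dense by blast
  have int: "set_integrable lebesgue (- ball x d) (F_kernel \<alpha> G u x)" if "b < \<alpha>" "\<alpha> < 2" for \<alpha>
    using b[OF that] \<open>0 < d\<close> by (auto simp: F_well_defined_def)
  define B where "B = (\<integral>z. d powr (\<beta> - 2) * \<bar>indicator (- ball x d) z *\<^sub>R F_kernel \<beta> G u x z\<bar> \<partial>lebesgue)"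
  have "\<bar>F_trunc \<alpha> G u x d\<bar> \<le> B" if "\<beta> < \<alpha>" "\<alpha> < 2" for \<alpha>
    unfolding F_trunc_def set_lebesgue_integral_def B_def
  proof (rule integral_abs_bound_integral)
    show "integrable lebesgue (\<lambda>z. indicator (- ball x d) z *\<^sub>R F_kernel \<alpha> G u x z)"
      using int[of \<alpha>] that \<beta> by (simp add: set_integrable_def)
    show "integrable lebesgue (\<lambda>z. d powr (\<beta> - 2) * \<bar>indicator (- ball x d) z *\<^sub>R F_kernel \<beta> G u x z\<bar>)"
      using int[of \<beta>] \<beta> unfolding set_integrable_def by (intro integrable_mult_right integrable_abs) auto
    show "\<bar>indicator (- ball x d) z *\<^sub>R F_kernel \<alpha> G u x z\<bar> \<le> d powr (\<beta> - 2) * \<bar>indicator (- ball x d) z *\<^sub>R F_kernel \<beta> G u x z\<bar>" for z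
    proof (cases "z \<in> ball x d")
      case False
      let ?r = "norm (x - z)" and ?n = "real CARD('n)"
      have r: "d \<le> ?r" "0 < ?r" using False \<open>0 < d\<close> by (auto simp: dist_norm)
      have "1 / ?r powr (?n + \<alpha>) = ?r powr (\<beta> - \<alpha>) * (1 / ?r powr (?n + \<beta>))"
        using r by (simp add: powr_minus_divide[symmetric] powr_add[symmetric] algebra_simps)
      also have "\<dots> \<le> d powr (\<beta> - 2) * (1 / ?r powr (?n + \<beta>))"
      proof (rule mult_right_mono)
        have "?r powr (\<beta> - \<alpha>) \<le> d powr (\<beta> - \<alpha>)"
          using r \<open>0 < d\<close> that by (intro powr_mono2') auto
        \<comment> \<open>Since \<open>d\<close> is at most 1, lowering the exponent increases the
          power; this makes the constant independent of \<alpha>.\<close>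
        also have "\<dots> \<le> d powr (\<beta> - 2)"
          using that assms by (intro powr_mono') auto
        finally show "?r powr (\<beta> - \<alpha>) \<le> d powr (\<beta> - 2)" .
      qed simp
      finally have "\<bar>G (u x - u z)\<bar> * (1 / ?r powr (?n + \<alpha>)) \<le> \<bar>G (u x - u z)\<bar> * (d powr (\<beta> - 2) * (1 / ?r powr (?n + \<beta>)))"
        by (rule mult_left_mono) simp
      then show ?thesis using False by (simp add: F_kernel_def abs_mult mult_ac)
    qed simp
  qed
  then have "\<forall>\<^sub>F \<alpha> in at_left 2. norm ((2 - \<alpha>) * F_trunc \<alpha> G u x d) \<le> (2 - \<alpha>) * B"
    unfolding eventually_at_left_field using \<beta> by (intro exI[of _ \<beta>]) (auto simp: abs_mult intro!: mult_left_mono)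
  moreover have "((\<lambda>\<alpha>. (2 - \<alpha>) * B) \<longlongrightarrow> 0) (at_left 2)"
    by (auto intro!: tendsto_eq_intros)
  ultimately show ?thesis by (rule Lim_null_comparison)
qed

text \<open>The order of choices matters: \<eta> is fixed from the target accuracy, the radius
  \<open>d\<close> from \<eta>, and only then does \<alpha> tend to 2.\<close>

lemma tendsto_F_op:
  fixes u :: "real^'n \<Rightarrow> real" and b :: "real^'n"
  assumes wd: "\<forall>\<^sub>F \<alpha> in at_left 2. F_well_defined \<alpha> G u x" and E: "linear E"
    and taylor: "\<And>\<eta>. 0 < \<eta> \<Longrightarrow> \<exists>d>0. \<forall>h. norm h < d \<longrightarrow> \<bar>G (u x - u (x + h)) - b \<bullet> h - (E h \<bullet> h) / 2\<bar> \<le> \<eta> * (norm h)\<^sup>2"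
  shows "((\<lambda>\<alpha>. F_op c \<alpha> G u x) \<longlongrightarrow> c CARD('n) * (unit_ball_vol (real CARD('n)) * ((\<Sum>i\<in>UNIV. E (axis i 1) $ i) / 2))) (at_left 2)"
proof -
  let ?V = "unit_ball_vol (real CARD('n))" and ?q = "(\<Sum>i\<in>UNIV. E (axis i 1) $ i) / 2"
  let ?H = "\<lambda>\<alpha>. (2 - \<alpha>) * Lim (at_right 0) (F_trunc \<alpha> G u x)"
  have "(?H \<longlongrightarrow> ?V * ?q) (at_left 2)"
  proof (rule tendstoI)
    fix \<epsilon> :: real assume "0 < \<epsilon>"
    \<comment> \<open>With this choice the Taylor error tends to half of \<epsilon>.\<close>
    define \<eta> where "\<eta> = \<epsilon> / (2 * (real CARD('n) * ?V))"
    have V: "0 < real CARD('n) * ?V" by simp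
    have "0 < \<eta>" using V \<open>0 < \<epsilon>\<close> by (auto simp: \<eta>_def)
    from taylor[OF this] obtain d' where "0 < d'"
      and d': "\<And>h. norm h < d' \<Longrightarrow> \<bar>G (u x - u (x + h)) - b \<bullet> h - (E h \<bullet> h) / 2\<bar> \<le> \<eta> * (norm h)\<^sup>2"
      by blast
    \<comment> \<open>The cap at 1 is required by the tail estimate.\<close>
    define d where "d = min d' 1"
    have d: "0 < d" "d \<le> 1" using \<open>0 < d'\<close> by (auto simp: d_def)
    \<comment> \<open>The three terms are the tail beyond \<open>d\<close>, the cost of replacing
      \<open>d powr (2 - \<alpha>)\<close> by 1, and the Taylor error.\<close>
    let ?err = "\<lambda>\<alpha>. \<bar>(2 - \<alpha>) * F_trunc \<alpha> G u x d\<bar> + \<bar>?V * ?q * (d powr (2 - \<alpha>) - 1)\<bar> + \<eta> * (real CARD('n) * ?V * d powr (2 - \<alpha>))"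
    have "(?err \<longlongrightarrow> \<bar>0\<bar> + \<bar>?V * ?q * (d powr (2 - 2) - 1)\<bar> + \<eta> * (real CARD('n) * ?V * d powr (2 - 2))) (at_left 2)"
      using d by (intro tendsto_intros tendsto_F_trunc_tail wd) auto
    moreover have "\<bar>0\<bar> + \<bar>?V * ?q * (d powr (2 - 2) - 1)\<bar> + \<eta> * (real CARD('n) * ?V * d powr (2 - 2)) < \<epsilon>"
      using d V \<open>0 < \<epsilon>\<close> by (simp add: \<eta>_def)
    ultimately have "\<forall>\<^sub>F \<alpha> in at_left 2. ?err \<alpha> < \<epsilon>"
      by (rule order_tendstoD)
    moreover have "\<forall>\<^sub>F \<alpha>::real in at_left 2. 0 < \<alpha>" "\<forall>\<^sub>F \<alpha>::real in at_left 2. \<alpha> < 2"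
      by (auto simp: eventually_at_left_field intro!: exI[of _ 0])
    ultimately show "\<forall>\<^sub>F \<alpha> in at_left 2. dist (?H \<alpha>) (?V * ?q) < \<epsilon>"
      using wd
    proof eventually_elim
      case (elim \<alpha>)
      have "\<bar>?H \<alpha> - (2 - \<alpha>) * F_trunc \<alpha> G u x d - ?V * ?q * d powr (2 - \<alpha>)\<bar> \<le> \<eta> * (real CARD('n) * ?V * d powr (2 - \<alpha>))"
        using elim d d' E by (intro principal_value_bound) (auto simp: d_def)
      with elim(1) show ?case
        unfolding dist_real_def right_diff_distrib mult_1_right by linarith
    qed
  qed
  then show ?thesis
    unfolding F_op_def mult.assoc by (rule tendsto_mult_left)
qed

theorem theorem7:
  fixes c :: "nat \<Rightarrow> real"
  assumes c_pos: "\<forall>n\<ge>1. c n > 0"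
  shows "\<exists>\<kappa>\<^sub>1 \<kappa>\<^sub>2 :: real. \<forall>(u :: real ^ 'n \<Rightarrow> real) (G :: real \<Rightarrow> real) (x :: real ^ 'n).
    u \<in> C11_loc \<longrightarrow>
    (\<forall>\<^sub>F \<alpha> in at_left 2. u \<in> L_space \<alpha>) \<longrightarrow>
    twice_differentiable G \<longrightarrow> G 0 = 0 \<longrightarrow>
    (\<forall>\<^sub>F \<alpha> in at_left 2. F_well_defined \<alpha> G u x) \<longrightarrow>
    grad u differentiable (at x) \<longrightarrow>
    (let a = \<kappa>\<^sub>1 * deriv G 0; b = \<kappa>\<^sub>2 * deriv (deriv G) 0 in
      ((\<lambda>\<alpha>. F_op c \<alpha> G u x) \<longlongrightarrow> a * (- laplacian u x) + b * (norm (grad u x))\<^sup>2) (at_left 2))"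
proof -
  \<comment> \<open>One constant serves for both coefficients, as both come from the trace of a
    single Hessian; the \<open>1 / 2\<close> is that of the Taylor formula.\<close>
  define \<kappa> where "\<kappa> = c CARD('n) * unit_ball_vol (real CARD('n)) / 2"
  have "((\<lambda>\<alpha>. F_op c \<alpha> G u x) \<longlongrightarrow> \<kappa> * deriv G 0 * (- laplacian u x) + \<kappa> * deriv (deriv G) 0 * (norm (grad u x))\<^sup>2) (at_left 2)"
    if u: "u \<in> C11_loc" and G: "twice_differentiable G" "G 0 = 0"
      and wd: "\<forall>\<^sub>F \<alpha> in at_left 2. F_well_defined \<alpha> G u x"
      and "grad u differentiable (at x)" for u :: "real^'n \<Rightarrow> real" and G x
  proof -
    obtain D where D: "(grad u has_derivative D) (at x)"
      using \<open>grad u differentiable (at x)\<close> by (auto simp: differentiable_def)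
    \<comment> \<open>\<open>E\<close> is the Hessian at 0 of
      \<open>h \<mapsto> G (u x - u (x + h))\<close>, and \<open>g\<close> below is its gradient
      field.\<close>
    define E where "E k = (deriv (deriv G) 0 * (grad u x \<bullet> k)) *\<^sub>R grad u x - deriv G 0 *\<^sub>R D k" for k
    define g where "g h = - deriv G (u x - u (x + h)) *\<^sub>R grad u (x + h)" for h
    have u': "\<And>y. u differentiable (at y)" and G': "\<And>t. G differentiable (at t)" "\<And>t. deriv G differentiable (at t)"
      using u G by (auto simp: C11_loc_def twice_differentiable_def)
    note der = has_derivative_difference_gradient[OF u' D G', folded g_def E_def]
    have lin: "linear E"
      using has_derivative_linear[OF der(2)] .
    \<comment> \<open>The constant term of the expansion is \<open>G 0\<close>, which is 0.\<close>
    have taylor: "\<exists>d>0. \<forall>h. norm h < d \<longrightarrow> \<bar>G (u x - u (x + h)) - g 0 \<bullet> h - (E h \<bullet> h) / 2\<bar> \<le> \<eta> * (norm h)\<^sup>2" if "0 < \<eta>" for \<eta>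
      using second_order_taylor[OF der that] G(2) by simp
    have "(\<Sum>i\<in>UNIV. E (axis i 1) $ i) = deriv (deriv G) 0 * (norm (grad u x))\<^sup>2 - deriv G 0 * laplacian u x"
      unfolding laplacian_eq[OF D] power2_norm_eq_inner
      by (simp add: E_def sum_subtractf inner_axis inner_vec_def[of "grad u x" "grad u x"] sum_distrib_left mult.assoc)
    with tendsto_F_op[OF wd lin taylor, of c] show ?thesis
      by (simp add: \<kappa>_def algebra_simps diff_divide_distrib)
  qed
  then show ?thesis
    unfolding Let_def by blast
qed

end
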